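(* Let $(\Omega,\mathcal F)$ be a measurable space carrying a sequence of real random variables $(X_n)_{n\in\mathbb N}$, let $S_n:=\sum_{i=1}^nX_i$, and let $(\mathcal F_n)_{n\in\mathbb N_0}$ be the filtration generated by $(X_n)_{n\in\mathbb N}$. Let $\mathcal P$ be a family of probability measures on $(\Omega,\mathcal F)$ such that under each $\mathsf P\in\mathcal P$ the sequence $(X_n)_{n\in\mathbb N}$ is i.i.d. and integrable with $\mathsf E_{\mathsf P}[X_1]=0$, and such that $0<\mathrm{Var}_{\mathsf P}[X_1]\le\overline\sigma^2<\infty$ for every $\mathsf P\in\mathcal P$, where $\overline\sigma\in(0,\infty)$. Define the event lattice $$\mathcal A_{\mathrm{fluc}}:=\left(\bigcup_{k\ge m}\left\{\frac{|S_k/\overline\sigma|}{\sqrt{2k\log\log k}}\ge1+\varepsilon\right\}\right)_{(m,\varepsilon)\in\mathbb N\times\mathbb R^+}.$$ Then $$\forall\varepsilon>0,\quad\lim_{m\to\infty}\sup_{\mathsf P\in\mathcal P}\mathsf P\left[\sup_{k\ge m}\frac{|S_k/\overline\sigma|}{\sqrt{2k\log\log k}}\ge1+\varepsilon\right]=0$$ if and only if there exists a $\mathcal P$-$e$-process that diverges pathwise to $\infty$ tail-uniformly on $\mathcal A_{\mathrm{fluc}}$.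
   Context: $\mathbb N=\{1,2,\dots\}$, $\mathbb N_0=\{0,1,2,\dots\}$, $\mathbb R^+=(0,\infty)$. $\log\log n$ is read as $\log\log(n\vee3)$ for $n\in\{1,2\}$. Event lattice: a collection of events $(A^{(m,\varepsilon)})_{(m,\varepsilon)\in\mathbb N\times\mathbb R^+}$ with $A^{(m_1,\varepsilon_1)}\supseteq A^{(m_2,\varepsilon_2)}$ whenever $m_1\le m_2$ and $\varepsilon_1\le\varepsilon_2$. $e$-process: a nonnegative $(\mathcal F_n)_{n\in\mathbb N_0}$-adapted process $(E_n)_{n\in\mathbb N_0}$ is a $\mathsf P$-$e$-process if $\mathsf E_{\mathsf P}[E_\tau]\le1$ for every $(\mathcal F_n)_{n\in\mathbb N_0}$-stopping time $\tau$ (possibly taking the value $\infty$), with the convention $E_\infty=\limsup_nE_n$. It is a $\mathcal P$-$e$-process if this holds for all $\mathsf P\in\mathcal P$. Tail-uniform divergence: a process $(E_n)_{n\in\mathbb N_0}$ diverges pathwise to $\infty$ tail-uniformly on an event lattice $(A^{(m,\varepsilon)})_{(m,\varepsilon)\in\mathbb N\times\mathbb R^+}$ if for all $\varepsilon>0$, $\lim_{m\to\infty}\inf_{\omega\in A^{(m,\varepsilon)}}\sup_{n\in\mathbb N}E_n(\omega)=\infty$ (with $\inf\emptyset=\infty$). *)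

theory Defs
  imports "HOL-Probability.Probability"
begin

text \<open>
  A measurable space is represented by a measure \<open>M\<close> of which only \<open>space M\<close> and \<open>sets M\<close> matter;
  a probability measure on it is a \<open>P\<close> with \<open>prob_space P\<close> and \<open>sets P = sets M\<close>.
  Sequences \<open>X\<^sub>1, X\<^sub>2, \<dots>\<close> are functions on \<^typ>\<open>nat\<close> whose value at \<open>0\<close> is never used.
\<close>

text \<open>The iterated logarithm is read as \<open>log log 3\<close> at \<open>1\<close> and \<open>2\<close>.\<close>

definition loglog :: "nat \<Rightarrow> real" where
  "loglog k = ln (ln (real (max k 3)))"

definition partial_sum :: "(nat \<Rightarrow> 'a \<Rightarrow> real) \<Rightarrow> nat \<Rightarrow> 'a \<Rightarrow> real" where
  "partial_sum X n \<omega> = (\<Sum>i\<in>{1..n}. X i \<omega>)"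

definition fluc_stat :: "(nat \<Rightarrow> 'a \<Rightarrow> real) \<Rightarrow> real \<Rightarrow> nat \<Rightarrow> 'a \<Rightarrow> real" where
  "fluc_stat X \<sigma> k \<omega> = \<bar>partial_sum X k \<omega> / \<sigma>\<bar> / sqrt (2 * real k * loglog k)"

definition generated_filtration ::
    "'a measure \<Rightarrow> (nat \<Rightarrow> 'a \<Rightarrow> real) \<Rightarrow> nat \<Rightarrow> 'a measure" where
  "generated_filtration M X n =
     sigma (space M) (\<Union>i\<in>{1..n}. {X i -` B \<inter> space M | B. B \<in> sets borel})"

definition adapted :: "(nat \<Rightarrow> 'a measure) \<Rightarrow> (nat \<Rightarrow> 'a \<Rightarrow> real) \<Rightarrow> bool" where
  "adapted F E \<longleftrightarrow> (\<forall>n. E n \<in> borel_measurable (F n))"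

text \<open>
  The library's stopping times take values in the index type of the filtration, so for stopping
  times with values in \<^typ>\<open>enat\<close> the filtration is extended by \<open>M\<close> at \<open>\<infinity>\<close>. The choice is immaterial:
  the condition at \<open>\<infinity>\<close> says that the event \<open>\<tau> \<le> \<infinity>\<close> is measurable.
\<close>

definition extended_stopping_time ::
    "'a measure \<Rightarrow> (nat \<Rightarrow> 'a measure) \<Rightarrow> ('a \<Rightarrow> enat) \<Rightarrow> bool" where
  "extended_stopping_time M F \<tau> \<longleftrightarrow>
     stopping_time (\<lambda>t. case t of enat n \<Rightarrow> F n | \<infinity> \<Rightarrow> M) \<tau>"

definition stopped_value :: "(nat \<Rightarrow> 'a \<Rightarrow> real) \<Rightarrow> ('a \<Rightarrow> enat) \<Rightarrow> 'a \<Rightarrow> ennreal" where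
  "stopped_value E \<tau> \<omega> =
     (case \<tau> \<omega> of enat n \<Rightarrow> ennreal (E n \<omega>) | \<infinity> \<Rightarrow> limsup (\<lambda>n. ennreal (E n \<omega>)))"

definition e_process ::
    "'a measure \<Rightarrow> (nat \<Rightarrow> 'a measure) \<Rightarrow> 'a measure set \<Rightarrow> (nat \<Rightarrow> 'a \<Rightarrow> real) \<Rightarrow> bool" where
  "e_process M F \<P> E \<longleftrightarrow>
     (\<forall>n. \<forall>\<omega>\<in>space M. 0 \<le> E n \<omega>) \<and>
     adapted F E \<and>
     (\<forall>P\<in>\<P>. \<forall>\<tau>. extended_stopping_time M F \<tau> \<longrightarrow> (\<integral>\<^sup>+ \<omega>. stopped_value E \<tau> \<omega> \<partial>P) \<le> 1)"

definition event_lattice :: "'a measure \<Rightarrow> (nat \<Rightarrow> real \<Rightarrow> 'a set) \<Rightarrow> bool" where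
  "event_lattice M A \<longleftrightarrow>
     (\<forall>m\<ge>1. \<forall>\<epsilon>>0. A m \<epsilon> \<in> sets M) \<and>
     (\<forall>m\<^sub>1 m\<^sub>2 \<epsilon>\<^sub>1 \<epsilon>\<^sub>2. 1 \<le> m\<^sub>1 \<and> m\<^sub>1 \<le> m\<^sub>2 \<and> 0 < \<epsilon>\<^sub>1 \<and> \<epsilon>\<^sub>1 \<le> \<epsilon>\<^sub>2 \<longrightarrow> A m\<^sub>2 \<epsilon>\<^sub>2 \<subseteq> A m\<^sub>1 \<epsilon>\<^sub>1)"

text \<open>The infimum and supremum are taken in \<^typ>\<open>ereal\<close>, where the infimum over the empty set is \<open>\<infinity>\<close>.\<close>

definition diverges_tail_uniformly ::
    "(nat \<Rightarrow> 'a \<Rightarrow> real) \<Rightarrow> (nat \<Rightarrow> real \<Rightarrow> 'a set) \<Rightarrow> bool" where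
  "diverges_tail_uniformly E A \<longleftrightarrow>
     (\<forall>\<epsilon>>0. (\<lambda>m. INF \<omega>\<in>A m \<epsilon>. SUP n\<in>{1..}. ereal (E n \<omega>)) \<longlonglongrightarrow> \<infinity>)"

definition fluc_lattice ::
    "'a measure \<Rightarrow> (nat \<Rightarrow> 'a \<Rightarrow> real) \<Rightarrow> real \<Rightarrow> nat \<Rightarrow> real \<Rightarrow> 'a set" where
  "fluc_lattice M X \<sigma> m \<epsilon> = (\<Union>k\<in>{m..}. {\<omega>\<in>space M. fluc_stat X \<sigma> k \<omega> \<ge> 1 + \<epsilon>})"

lemma event_lattice_fluc:
  assumes "\<And>i. i \<ge> 1 \<Longrightarrow> X i \<in> borel_measurable M"
  shows "event_lattice M (fluc_lattice M X \<sigma>)"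
proof -
  have stat: "fluc_stat X \<sigma> k \<in> borel_measurable M" for k
  proof -
    have "(\<lambda>\<omega>. \<Sum>i\<in>{1..k}. X i \<omega>) \<in> borel_measurable M"
      by (rule borel_measurable_sum) (use assms in auto)
    then show ?thesis
      unfolding fluc_stat_def[abs_def] partial_sum_def[abs_def]
      by (intro borel_measurable_divide borel_measurable_abs borel_measurable_const)
  qed
  have "{\<omega>\<in>space M. fluc_stat X \<sigma> k \<omega> \<ge> 1 + \<epsilon>} \<in> sets M" for k \<epsilon>
    by (rule borel_measurable_le[OF borel_measurable_const stat])
  then have "fluc_lattice M X \<sigma> m \<epsilon> \<in> sets M" for m \<epsilon>
    unfolding fluc_lattice_def by (intro sets.countable_UN') auto
  moreover have "fluc_lattice M X \<sigma> m2 e2 \<subseteq> fluc_lattice M X \<sigma> m1 e1"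
    if "m1 \<le> m2" "e1 \<le> e2" for m1 m2 :: nat and e1 e2 :: real
    unfolding fluc_lattice_def
  proof (rule UN_mono)
    show "{m2..} \<subseteq> {m1..}" using that by simp
    show "{\<omega>\<in>space M. 1 + e2 \<le> fluc_stat X \<sigma> k \<omega>} \<subseteq> {\<omega>\<in>space M. 1 + e1 \<le> fluc_stat X \<sigma> k \<omega>}" for k
      using that by auto
  qed
  ultimately show ?thesis
    unfolding event_lattice_def by simp
qed

definition iid :: "'a measure \<Rightarrow> (nat \<Rightarrow> 'a \<Rightarrow> real) \<Rightarrow> bool" where
  "iid P X \<longleftrightarrow>
     prob_space.indep_vars P (\<lambda>_. borel) X {1..} \<and>
     (\<forall>i\<ge>1. distr P borel (X i) = distr P borel (X 1))"

end

theory Submission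
  imports Defs
begin

text \<open>
  The fluctuation lattice has the form \<open>A m \<epsilon> = (\<Union>k\<ge>m. B k \<epsilon>)\<close> with events \<open>B k \<epsilon>\<close> that are decided
  at time \<open>k\<close> and shrink as \<open>\<epsilon>\<close> grows. This structure is what allows an e-process to be built from
  the indicators of the lattice; the other implication is an instance of Ville's inequality.

  If an e-process \<open>E\<close> diverges tail-uniformly, then for every level \<open>c\<close> and all large \<open>m\<close> the event
  \<open>A m \<epsilon>\<close> forces \<open>E\<close> above \<open>c\<close>. Ville's inequality, which for e-processes is Markov's inequality at
  the first passage time above \<open>c\<close>, bounds its probability by \<open>1 / c\<close> under all \<open>P \<in> \<P>\<close> at once
  (\<open>uniformly_null_if_diverging\<close>).

  Conversely, let the probabilities vanish uniformly. Choose thresholds \<open>m j\<close> such that the event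
  \<open>A (m j) (1 / (j + 1))\<close> has probability at most \<open>(1 / 2) ^ (j + 1)\<close> under all \<open>P \<in> \<P>\<close>,
  and let \<open>E n\<close> count the indices \<open>j < n\<close> for which this event has been seen to occur by time \<open>n\<close>. The count is
  nondecreasing in \<open>n\<close>, so at any stopping time it is dominated by its limit, whose expectation is at
  most \<open>(\<Sum>j. (1 / 2) ^ (j + 1)) = 1\<close>. On \<open>A m \<epsilon>\<close> every index \<open>j\<close> with \<open>1 / (j + 1) \<le> \<epsilon>\<close> and \<open>m j \<le> m\<close> is
  eventually counted, and the number of these grows without bound as \<open>m\<close> increases
  (\<open>diverging_e_process_if_uniformly_null\<close>).

  The event that the supremum of the statistics from time \<open>m\<close> on reaches \<open>1 + \<epsilon>\<close> differs from
  \<open>A m \<epsilon>\<close> in that the supremum need not be attained. It lies between \<open>A m \<epsilon>\<close> and \<open>A m (\<epsilon> / 2)\<close>,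
  so both families vanish uniformly together.
\<close>

section \<open>Ville's inequality for e-processes\<close>

text \<open>
  Stop at the first time the process exceeds \<open>c\<close>. The stopped value is above \<open>c\<close> wherever this time
  is finite, and its expectation is at most \<open>1\<close>, so Markov's inequality applies. Where the time is
  infinite, nonnegativity of the stopped value suffices.
\<close>

lemma e_process_maximal_inequality:
  fixes c :: real
  assumes filt: "filtration (space M) F"
    and sub: "\<And>n. sets (F n) \<subseteq> sets M"
    and E: "e_process M F \<P> E"
    and P: "P \<in> \<P>" "sets P = sets M"
    and c: "0 < c"
  shows "{\<omega>\<in>space M. \<exists>n. c < E n \<omega>} \<in> sets M"
    and "emeasure P {\<omega>\<in>space M. \<exists>n. c < E n \<omega>} \<le> ennreal (1 / c)"
proof -
  interpret filtration "space M" F by (fact filt)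
  define \<tau> where "\<tau> \<omega> = (if \<exists>n. c < E n \<omega> then enat (LEAST n. c < E n \<omega>) else \<infinity>)" for \<omega>
  let ?C = "{\<omega>\<in>space M. \<exists>n. c < E n \<omega>}"
  have passed: "{\<omega>\<in>space M. c < E i \<omega>} \<in> sets (F n)" if "i \<le> n" for i n
  proof -
    have "E i \<in> borel_measurable (F i)"
      using E by (simp add: e_process_def adapted_def)
    then have "{\<omega>\<in>space (F i). c < E i \<omega>} \<in> sets (F i)"
      by measurable
    then show ?thesis
      using sets_F_mono[OF that] by (auto simp: space_F)
  qed
  have "(\<Union>n. {\<omega>\<in>space M. c < E n \<omega>}) \<in> sets M"
    using subsetD[OF sub passed[OF order_refl]] by (intro sets.countable_UN image_subsetI)
  moreover have "?C = (\<Union>n. {\<omega>\<in>space M. c < E n \<omega>})"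
    by auto
  ultimately show C: "?C \<in> sets M"
    by (simp only:)
  have \<tau>_le: "\<tau> \<omega> \<le> enat n \<longleftrightarrow> (\<exists>i\<le>n. c < E i \<omega>)" for \<omega> n
    unfolding \<tau>_def by (auto intro: Least_le order_trans dest: LeastI)
  have "extended_stopping_time M F \<tau>"
    unfolding extended_stopping_time_def stopping_time_def
  proof
    fix t :: enat
    show "Measurable.pred (case t of enat n \<Rightarrow> F n | \<infinity> \<Rightarrow> M) (\<lambda>\<omega>. \<tau> \<omega> \<le> t)"
    proof (cases t)
      case (enat n)
      have "{\<omega>\<in>space (F n). \<tau> \<omega> \<le> enat n} = (\<Union>i\<in>{..n}. {\<omega>\<in>space M. c < E i \<omega>})"
        by (auto simp: \<tau>_le space_F)
      also have "\<dots> \<in> sets (F n)"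
        using passed by auto
      finally show ?thesis
        by (simp add: enat pred_def)
    qed simp
  qed
  then have "(\<integral>\<^sup>+ \<omega>. stopped_value E \<tau> \<omega> \<partial>P) \<le> 1"
    using E P by (simp add: e_process_def)
  moreover have "(\<integral>\<^sup>+ \<omega>. ennreal c * indicator ?C \<omega> \<partial>P) \<le> (\<integral>\<^sup>+ \<omega>. stopped_value E \<tau> \<omega> \<partial>P)"
  proof (rule nn_integral_mono)
    fix \<omega>
    show "ennreal c * indicator ?C \<omega> \<le> stopped_value E \<tau> \<omega>"
    proof (cases "\<omega> \<in> ?C")
      case True
      then have ex: "\<exists>n. c < E n \<omega>"
        by simp
      have "c < E (LEAST n. c < E n \<omega>) \<omega>"
        using ex by (rule LeastI_ex)
      then have "ennreal c \<le> ennreal (E (LEAST n. c < E n \<omega>) \<omega>)"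
        by (simp add: ennreal_leI)
      moreover have "stopped_value E \<tau> \<omega> = ennreal (E (LEAST n. c < E n \<omega>) \<omega>)"
        using ex unfolding stopped_value_def \<tau>_def by (simp only: if_True enat.case)
      ultimately show ?thesis
        using True by simp
    qed simp
  qed
  ultimately have "ennreal c * emeasure P ?C \<le> 1"
    using C P by (simp add: nn_integral_cmult_indicator)
  then have "ennreal (1 / c) * (ennreal c * emeasure P ?C) \<le> ennreal (1 / c) * 1"
    by (intro mult_left_mono) auto
  then show "emeasure P ?C \<le> ennreal (1 / c)"
    using c by (simp add: mult.assoc[symmetric] ennreal_mult[symmetric])
qed

section \<open>Tail-uniform divergence and uniformly vanishing probabilities\<close>

lemma uniformly_null_if_diverging:
  assumes filt: "filtration (space M) F"
    and sub: "\<And>n. sets (F n) \<subseteq> sets M"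
    and P: "\<And>P. P \<in> \<P> \<Longrightarrow> sets P = sets M"
    and A: "\<And>m. A m \<epsilon> \<subseteq> space M"
    and E: "e_process M F \<P> E"
    and div: "diverges_tail_uniformly E A"
    and \<epsilon>: "0 < \<epsilon>"
  shows "(\<lambda>m. SUP P\<in>\<P>. emeasure P (A m \<epsilon>)) \<longlonglongrightarrow> 0"
proof (rule tendsto_zero_ennreal)
  fix r :: real
  assume r: "0 < r"
  define c where "c = 2 / r"
  have c: "0 < c" "1 / c < r"
    using r by (auto simp: c_def)
  have "\<forall>\<^sub>F m in sequentially. ereal c < (INF \<omega>\<in>A m \<epsilon>. SUP n\<in>{1..}. ereal (E n \<omega>))"
    using div \<epsilon> unfolding diverges_tail_uniformly_def by (auto simp: tendsto_PInfty)
  then show "\<forall>\<^sub>F m in sequentially. (SUP P\<in>\<P>. emeasure P (A m \<epsilon>)) < ennreal r"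
  proof eventually_elim
    case (elim m)
    have above: "\<exists>n. c < E n \<omega>" if "\<omega> \<in> A m \<epsilon>" for \<omega>
    proof -
      have "ereal c < (SUP n\<in>{1..}. ereal (E n \<omega>))"
        using elim INF_lower[OF that] by (rule less_le_trans)
      then show ?thesis
        by (auto simp: less_SUP_iff)
    qed
    have "emeasure P (A m \<epsilon>) \<le> ennreal (1 / c)" if "P \<in> \<P>" for P
    proof -
      note Ville = e_process_maximal_inequality[OF filt sub E that P[OF that] c(1)]
      have "emeasure P (A m \<epsilon>) \<le> emeasure P {\<omega>\<in>space M. \<exists>n. c < E n \<omega>}"
        using above A Ville(1) P[OF that] by (intro emeasure_mono) auto
      also note Ville(2)
      finally show ?thesis .
    qed
    then have "(SUP P\<in>\<P>. emeasure P (A m \<epsilon>)) \<le> ennreal (1 / c)"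
      by (rule SUP_least)
    also have "\<dots> < ennreal r"
      using c by (simp add: ennreal_less_iff)
    finally show ?case .
  qed
qed

text \<open>
  The witness is the counting process described at the top. By \<open>adp\<close>, whether some
  \<open>B k \<epsilon>\<close> with \<open>k \<le> n\<close> has occurred is known at time \<open>n\<close>, so the count is adapted. By \<open>anti\<close> an occurrence of
  \<open>B k \<epsilon>\<close> is an occurrence of \<open>B k (1 / (j + 1))\<close> for all but finitely many \<open>j\<close>, so that one process
  serves every \<open>\<epsilon>\<close>.
\<close>

lemma diverging_e_process_if_uniformly_null:
  fixes B :: "nat \<Rightarrow> real \<Rightarrow> 'a set" and F :: "nat \<Rightarrow> 'a measure"
  assumes filt: "filtration (space M) F"
    and sub: "\<And>n. sets (F n) \<subseteq> sets M"
    and P: "\<And>P. P \<in> \<P> \<Longrightarrow> sets P = sets M"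
    and adp: "\<And>k \<epsilon>. B k \<epsilon> \<in> sets (F k)"
    and anti: "\<And>k \<epsilon> \<epsilon>'. \<epsilon> \<le> \<epsilon>' \<Longrightarrow> B k \<epsilon>' \<subseteq> B k \<epsilon>"
    and null: "\<And>\<epsilon>. 0 < \<epsilon> \<Longrightarrow> (\<lambda>m. SUP P\<in>\<P>. emeasure P (\<Union>k\<in>{m..}. B k \<epsilon>)) \<longlonglongrightarrow> 0"
  obtains E where "e_process M F \<P> E"
    and "diverges_tail_uniformly E (\<lambda>m \<epsilon>. \<Union>k\<in>{m..}. B k \<epsilon>)"
proof -
  interpret filtration "space M" F by (fact filt)
  let ?\<delta> = "\<lambda>j::nat. 1 / real (Suc j)"
  have "\<exists>m. (SUP P\<in>\<P>. emeasure P (\<Union>k\<in>{m..}. B k (?\<delta> j))) < ennreal ((1 / 2) ^ Suc j)" for j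
  proof -
    have "\<forall>\<^sub>F m in sequentially.
        (SUP P\<in>\<P>. emeasure P (\<Union>k\<in>{m..}. B k (?\<delta> j))) < ennreal ((1 / 2) ^ Suc j)"
      by (rule order_tendstoD(2)[OF null]) auto
    then show ?thesis
      by (auto simp: eventually_sequentially)
  qed
  then obtain m where m:
      "\<And>j. (SUP P\<in>\<P>. emeasure P (\<Union>k\<in>{m j..}. B k (?\<delta> j))) < ennreal ((1 / 2) ^ Suc j)"
    by metis
  define D where "D j n = (\<Union>k\<in>{m j..n}. B k (?\<delta> j))" for j n
  define Dlim where "Dlim j = (\<Union>k\<in>{m j..}. B k (?\<delta> j))" for j
  define E :: "nat \<Rightarrow> 'a \<Rightarrow> real" where "E n \<omega> = (\<Sum>j<n. indicator (D j n) \<omega>)" for n \<omega>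
  have B_sets: "B k e \<in> sets (F n)" if "k \<le> n" for k n e
    using adp sets_F_mono[OF that] by auto
  have Dlim_sets: "Dlim j \<in> sets M" for j
    unfolding Dlim_def using adp sub by (intro sets.countable_UN') auto
  have adapted: "adapted F E"
    unfolding adapted_def
  proof
    fix n
    have "D j n \<in> sets (F n)" for j
      unfolding D_def using B_sets by (intro sets.countable_UN') auto
    then show "E n \<in> borel_measurable (F n)"
      unfolding E_def[abs_def] by (intro borel_measurable_sum borel_measurable_indicator)
  qed
  have limit: "ennreal (E n \<omega>) \<le> (\<Sum>j. indicator (Dlim j) \<omega>)" for n \<omega>
  proof -
    have "ennreal (E n \<omega>) = (\<Sum>j<n. indicator (D j n) \<omega>)"
      by (simp add: E_def flip: sum_ennreal ennreal_indicator)
    also have "\<dots> \<le> (\<Sum>j<n. indicator (Dlim j) \<omega>)"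
      by (intro sum_mono) (auto simp: indicator_def D_def Dlim_def)
    also have "\<dots> \<le> (\<Sum>j. indicator (Dlim j) \<omega>)"
      by (rule sum_le_suminf) auto
    finally show ?thesis .
  qed
  have stopped: "stopped_value E \<tau> \<omega> \<le> (\<Sum>j. indicator (Dlim j) \<omega>)" for \<tau> \<omega>
  proof (cases "\<tau> \<omega>")
    case (enat n)
    then show ?thesis
      using limit by (simp add: stopped_value_def)
  next
    case infinity
    have "limsup (\<lambda>n. ennreal (E n \<omega>)) \<le> (\<Sum>j. indicator (Dlim j) \<omega>)"
      by (rule Limsup_bounded) (auto simp: limit)
    with infinity show ?thesis
      by (simp add: stopped_value_def)
  qed
  have bound: "(\<integral>\<^sup>+ \<omega>. stopped_value E \<tau> \<omega> \<partial>P) \<le> 1" if PP: "P \<in> \<P>" for P \<tau>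
  proof -
    have meas: "Dlim j \<in> sets P" for j
      using Dlim_sets P[OF PP] by simp
    have "(\<integral>\<^sup>+ \<omega>. stopped_value E \<tau> \<omega> \<partial>P) \<le> (\<integral>\<^sup>+ \<omega>. (\<Sum>j. indicator (Dlim j) \<omega>) \<partial>P)"
      by (intro nn_integral_mono stopped)
    also have "\<dots> = (\<Sum>j. emeasure P (Dlim j))"
      using meas by (subst nn_integral_suminf) auto
    also have "\<dots> \<le> (\<Sum>j. ennreal ((1 / 2) ^ Suc j))"
    proof (rule suminf_le)
      fix j
      have "emeasure P (Dlim j) \<le> (SUP P\<in>\<P>. emeasure P (Dlim j))"
        using PP by (rule SUP_upper)
      also have "\<dots> \<le> ennreal ((1 / 2) ^ Suc j)"
        using m[of j] by (simp add: Dlim_def)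
      finally show "emeasure P (Dlim j) \<le> ennreal ((1 / 2) ^ Suc j)" .
    qed auto
    also have "\<dots> = 1"
      using power_half_series by (subst suminf_ennreal_eq) auto
    finally show ?thesis .
  qed
  have "e_process M F \<P> E"
    unfolding e_process_def using adapted bound by (auto simp: E_def sum_nonneg)
  moreover have "diverges_tail_uniformly E (\<lambda>m \<epsilon>. \<Union>k\<in>{m..}. B k \<epsilon>)"
    unfolding diverges_tail_uniformly_def tendsto_PInfty
  proof (intro allI impI)
    fix \<epsilon> r :: real
    assume \<epsilon>: "0 < \<epsilon>"
    obtain J where J: "?\<delta> J < \<epsilon>"
      using \<epsilon> nat_approx_posE by blast
    obtain K :: nat where K: "r < real K"
      using reals_Archimedean2 by blast
    define N where "N = Max (m ` {..J + K})"
    have N: "m j \<le> N" if "j < J + K" for j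
      unfolding N_def using that by (intro Max_ge) auto
    have count: "ereal (real K) \<le> (SUP n\<in>{1..}. ereal (E n \<omega>))"
      if "l \<ge> N" and \<omega>: "\<omega> \<in> (\<Union>k\<in>{l..}. B k \<epsilon>)" for l \<omega>
    proof -
      from \<omega> obtain k where k: "l \<le> k" "\<omega> \<in> B k \<epsilon>"
        by auto
      \<comment> \<open>By time \<open>n\<close> the occurrence at time \<open>k\<close> has been seen and the indices below \<open>J + K\<close> have entered
        the count; the single occurrence triggers each of the \<open>K\<close> indices from \<open>J\<close> on.\<close>
      define n where "n = max k (Suc (J + K))"
      have hit: "\<omega> \<in> D j n" if "j \<in> {J..<J + K}" for j
      proof -
        have "?\<delta> j \<le> ?\<delta> J"
          using that by (intro divide_left_mono) auto
        then have "\<omega> \<in> B k (?\<delta> j)"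
          using J k(2) anti[of "?\<delta> j" \<epsilon> k] by auto
        moreover have "m j \<le> k"
          using N[of j] that \<open>l \<ge> N\<close> k(1) by auto
        ultimately show ?thesis
          by (auto simp: D_def n_def)
      qed
      have "real K = (\<Sum>j\<in>{J..<J + K}. indicator (D j n) \<omega>)"
        using hit by simp
      also have "\<dots> \<le> E n \<omega>"
        unfolding E_def by (rule sum_mono2) (auto simp: n_def)
      finally have "ereal (real K) \<le> ereal (E n \<omega>)"
        by simp
      also have "\<dots> \<le> (SUP n\<in>{1..}. ereal (E n \<omega>))"
        by (rule SUP_upper) (simp add: n_def)
      finally show ?thesis .
    qed
    show "\<forall>\<^sub>F l in sequentially. ereal r < (INF \<omega>\<in>(\<Union>k\<in>{l..}. B k \<epsilon>). SUP n\<in>{1..}. ereal (E n \<omega>))"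
      using eventually_ge_at_top[of N]
    proof eventually_elim
      case (elim l)
      have "ereal r < ereal (real K)"
        using K by simp
      also have "\<dots> \<le> (INF \<omega>\<in>(\<Union>k\<in>{l..}. B k \<epsilon>). SUP n\<in>{1..}. ereal (E n \<omega>))"
        using count[OF elim] by (intro INF_greatest)
      finally show ?case .
    qed
  qed
  ultimately show thesis
    by (rule that)
qed

section \<open>The fluctuation lattice of the partial sums\<close>

lemma filtration_generated: "filtration (space M) (generated_filtration M X)"
proof
  show "space (generated_filtration M X n) = space M" for n
    unfolding generated_filtration_def by (rule space_measure_of) auto
  show "sets (generated_filtration M X i) \<subseteq> sets (generated_filtration M X j)" if "i \<le> j" for i j
    unfolding generated_filtration_def
  proof (subst (1 2) sets_measure_of)
    show "sigma_sets (space M) (\<Union>i\<in>{1..i}. {X i -` B \<inter> space M |B. B \<in> sets borel})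
        \<subseteq> sigma_sets (space M) (\<Union>i\<in>{1..j}. {X i -` B \<inter> space M |B. B \<in> sets borel})"
      using that by (intro sigma_sets_mono' UN_mono) auto
  qed auto
qed

lemma sets_generated_filtration_subset:
  assumes "\<And>i. i \<ge> 1 \<Longrightarrow> X i \<in> borel_measurable M"
  shows "sets (generated_filtration M X n) \<subseteq> sets M"
proof -
  have "(\<Union>i\<in>{1..n}. {X i -` B \<inter> space M |B. B \<in> sets borel}) \<subseteq> sets M"
    using assms by (auto intro: measurable_sets)
  then have "sigma_sets (space M) (\<Union>i\<in>{1..n}. {X i -` B \<inter> space M |B. B \<in> sets borel}) \<subseteq> sets M"
    by (rule sets.sigma_sets_subset)
  then show ?thesis
    unfolding generated_filtration_def by (subst sets_measure_of) auto
qed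

lemma fluc_stat_measurable_generated [measurable]:
  "fluc_stat X \<sigma> k \<in> borel_measurable (generated_filtration M X k)"
proof -
  have "X i \<in> borel_measurable (generated_filtration M X k)" if "i \<in> {1..k}" for i
  proof (rule measurableI)
    fix B :: "real set"
    assume "B \<in> sets borel"
    then have "X i -` B \<inter> space M \<in> (\<Union>i\<in>{1..k}. {X i -` B \<inter> space M |B. B \<in> sets borel})"
      using that by blast
    then have "X i -` B \<inter> space M \<in> sets (generated_filtration M X k)"
      unfolding generated_filtration_def by (intro in_measure_of) auto
    then show "X i -` B \<inter> space (generated_filtration M X k) \<in> sets (generated_filtration M X k)"
      by (simp add: filtration.space_F[OF filtration_generated])
  qed simp
  then have "(\<lambda>\<omega>. \<Sum>i\<in>{1..k}. X i \<omega>) \<in> borel_measurable (generated_filtration M X k)"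
    by (rule borel_measurable_sum)
  then show ?thesis
    unfolding fluc_stat_def[abs_def] partial_sum_def[abs_def]
    by (intro borel_measurable_divide borel_measurable_abs borel_measurable_const)
qed

theorem corollary5p6:
  fixes M :: "'a measure"
    and X :: "nat \<Rightarrow> 'a \<Rightarrow> real"
    and \<P> :: "'a measure set"
    and \<sigma> :: real
  assumes "\<And>i. i \<ge> 1 \<Longrightarrow> X i \<in> borel_measurable M"
    and "0 < \<sigma>"
    and "\<And>P. P \<in> \<P> \<Longrightarrow> prob_space P"
    and "\<And>P. P \<in> \<P> \<Longrightarrow> sets P = sets M"
    and "\<And>P. P \<in> \<P> \<Longrightarrow> iid P X"
    and "\<And>P. P \<in> \<P> \<Longrightarrow> integrable P (X 1)"
    and "\<And>P. P \<in> \<P> \<Longrightarrow> prob_space.expectation P (X 1) = 0"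
    and "\<And>P. P \<in> \<P> \<Longrightarrow> integrable P (\<lambda>\<omega>. (X 1 \<omega>)\<^sup>2)"
    and "\<And>P. P \<in> \<P> \<Longrightarrow> 0 < prob_space.variance P (X 1)"
    and "\<And>P. P \<in> \<P> \<Longrightarrow> prob_space.variance P (X 1) \<le> \<sigma>\<^sup>2"
  shows "(\<forall>\<epsilon>>0. (\<lambda>m. SUP P\<in>\<P>. emeasure P
              {\<omega>\<in>space M. (SUP k\<in>{m..}. ereal (fluc_stat X \<sigma> k \<omega>)) \<ge> ereal (1 + \<epsilon>)})
            \<longlonglongrightarrow> 0)
         \<longleftrightarrow>
         (\<exists>E. e_process M (generated_filtration M X) \<P> E \<and>
              diverges_tail_uniformly E (fluc_lattice M X \<sigma>))"
proof -
  let ?F = "generated_filtration M X"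
  let ?A = "fluc_lattice M X \<sigma>"
  let ?S = "\<lambda>m \<epsilon>. {\<omega>\<in>space M. (SUP k\<in>{m..}. ereal (fluc_stat X \<sigma> k \<omega>)) \<ge> ereal (1 + \<epsilon>)}"
  note filt = filtration_generated[of M X]
  have sub: "sets (?F n) \<subseteq> sets M" for n
    using assms(1) by (rule sets_generated_filtration_subset)
  have stat: "fluc_stat X \<sigma> k \<in> borel_measurable M" for k
    using fluc_stat_measurable_generated
    by (rule measurable_mono[THEN subsetD, rotated -1])
      (use sub filtration.space_F[OF filt] in auto)
  show ?thesis
  proof
    assume lim: "\<forall>\<epsilon>>0. (\<lambda>m. SUP P\<in>\<P>. emeasure P (?S m \<epsilon>)) \<longlonglongrightarrow> 0"
    have S_sets: "?S m \<epsilon> \<in> sets M" for m \<epsilon>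
      using stat by measurable
    have A_null: "(\<lambda>m. SUP P\<in>\<P>. emeasure P (?A m \<epsilon>)) \<longlonglongrightarrow> 0" if "0 < \<epsilon>" for \<epsilon>
    proof (rule tendsto_sandwich[OF _ _ tendsto_const])
      show "(\<lambda>m. SUP P\<in>\<P>. emeasure P (?S m \<epsilon>)) \<longlonglongrightarrow> 0"
        using lim that by blast
      have "?A m \<epsilon> \<subseteq> ?S m \<epsilon>" for m
        by (auto simp: fluc_lattice_def intro: SUP_upper2)
      then show "\<forall>\<^sub>F m in sequentially.
          (SUP P\<in>\<P>. emeasure P (?A m \<epsilon>)) \<le> (SUP P\<in>\<P>. emeasure P (?S m \<epsilon>))"
        by (intro always_eventually allI SUP_subset_mono[OF order_refl] emeasure_mono)
          (simp_all add: assms(4) S_sets)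
    qed simp
    let ?B = "\<lambda>k \<epsilon>. {\<omega>\<in>space M. 1 + \<epsilon> \<le> fluc_stat X \<sigma> k \<omega>}"
    have A_eq: "?A = (\<lambda>m \<epsilon>. \<Union>k\<in>{m..}. ?B k \<epsilon>)"
      by (simp add: fluc_lattice_def fun_eq_iff)
    show "\<exists>E. e_process M ?F \<P> E \<and> diverges_tail_uniformly E ?A"
      unfolding A_eq
    proof (rule diverging_e_process_if_uniformly_null
        [where B = ?B and F = ?F and \<P> = \<P>, OF filt sub])
      show "?B k \<epsilon> \<in> sets (?F k)" for k \<epsilon>
      proof -
        have "{\<omega>\<in>space (?F k). 1 + \<epsilon> \<le> fluc_stat X \<sigma> k \<omega>} \<in> sets (?F k)"
          by measurable
        then show ?thesis
          by (simp only: filtration.space_F[OF filt])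
      qed
      show "?B k \<epsilon>' \<subseteq> ?B k \<epsilon>" if "\<epsilon> \<le> \<epsilon>'" for k \<epsilon> \<epsilon>'
        using that by auto
      show "(\<lambda>m. SUP P\<in>\<P>. emeasure P (\<Union>k\<in>{m..}. ?B k \<epsilon>)) \<longlonglongrightarrow> 0" if "0 < \<epsilon>" for \<epsilon>
        using A_null[OF that] by (simp only: A_eq)
    qed (use assms(4) in blast)+
  next
    assume "\<exists>E. e_process M ?F \<P> E \<and> diverges_tail_uniformly E ?A"
    then obtain E where E: "e_process M ?F \<P> E" "diverges_tail_uniformly E ?A"
      by blast
    have A_sets: "?A m \<epsilon> \<in> sets M" for m \<epsilon>
      unfolding fluc_lattice_def using stat by (intro sets.countable_UN') auto
    show "\<forall>\<epsilon>>0. (\<lambda>m. SUP P\<in>\<P>. emeasure P (?S m \<epsilon>)) \<longlonglongrightarrow> 0"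
    proof (intro allI impI)
      fix \<epsilon> :: real
      assume \<epsilon>: "0 < \<epsilon>"
      show "(\<lambda>m. SUP P\<in>\<P>. emeasure P (?S m \<epsilon>)) \<longlonglongrightarrow> 0"
      proof (rule tendsto_sandwich[OF _ _ tendsto_const])
        show "(\<lambda>m. SUP P\<in>\<P>. emeasure P (?A m (\<epsilon> / 2))) \<longlonglongrightarrow> 0"
          by (rule uniformly_null_if_diverging[OF filt sub assms(4) _ E])
            (use \<epsilon> in \<open>auto simp: fluc_lattice_def\<close>)
        have "?S m \<epsilon> \<subseteq> ?A m (\<epsilon> / 2)" for m
        proof
          fix \<omega>
          assume \<omega>: "\<omega> \<in> ?S m \<epsilon>"
          have "ereal (1 + \<epsilon> / 2) < ereal (1 + \<epsilon>)"
            using \<epsilon> by simp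
          also have "\<dots> \<le> (SUP k\<in>{m..}. ereal (fluc_stat X \<sigma> k \<omega>))"
            using \<omega> by simp
          finally obtain k where "k \<ge> m" "1 + \<epsilon> / 2 < fluc_stat X \<sigma> k \<omega>"
            by (auto simp: less_SUP_iff)
          with \<omega> show "\<omega> \<in> ?A m (\<epsilon> / 2)"
            by (auto simp: fluc_lattice_def intro!: bexI[of _ k])
        qed
        then show "\<forall>\<^sub>F m in sequentially.
            (SUP P\<in>\<P>. emeasure P (?S m \<epsilon>)) \<le> (SUP P\<in>\<P>. emeasure P (?A m (\<epsilon> / 2)))"
          by (intro always_eventually allI SUP_subset_mono[OF order_refl] emeasure_mono) (simp_all add: assms(4) A_sets)
      qed simp
    qed
  qed
qed

end
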